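(* Let $f:\mathbb{R}^n\to\mathbb{R}$ be $L$-smooth and $\alpha$-strongly convex ($L,\alpha>0$), let $\Psi:\mathbb{R}^n\to\mathbb{R}\cup\{+\infty\}$ be closed, proper and convex, and let $F=f+\Psi$. Let the numbers $\tilde\xi_k^2$ be generated by the geometric descent algorithm described in the context. Then for $k=1,2,\ldots$, $$\tilde\xi_{k+1}^2\le\left(1-\sqrt{\frac{\alpha}{L}}\right)\tilde\xi_k^2 .$$
   Context: $f$ is $L$-smooth if it is differentiable and $|f(\mathbf{x})-f(\mathbf{y})-\nabla f(\mathbf{y})^T(\mathbf{x}-\mathbf{y})|\le (L/2)\|\mathbf{x}-\mathbf{y}\|^2$ for all $\mathbf{x},\mathbf{y}$; $f$ is $\alpha$-strongly convex if $f(\mathbf{y})\ge f(\mathbf{x})+\nabla f(\mathbf{x})^T(\mathbf{y}-\mathbf{x})+(\alpha/2)\|\mathbf{x}-\mathbf{y}\|^2$ for all $\mathbf{x},\mathbf{y}$. For $t>0$, $\mathrm{prox}_{t\Psi}(\mathbf{x})=\operatorname{argmin}_{\mathbf{z}}\{\Psi(\mathbf{z})+\|\mathbf{x}-\mathbf{z}\|^2/(2t)\}$, and $G_t(\mathbf{x})=t^{-1}(\mathbf{x}-\mathrm{prox}_{t\Psi}(\mathbf{x}-t\nabla f(\mathbf{x})))$. For every $k$ write $\bar{\mathbf{z}}_k=\mathbf{z}_k-\frac{1}{L}G_{1/L}(\mathbf{z}_k)$ and $\bar{\bar{\mathbf{z}}}_k=\mathbf{z}_k-\frac1\alpha G_{1/L}(\mathbf{z}_k)$.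 Geometric descent (strongly convex composite case). Fix $\mathbf{x}_0\in\mathbb{R}^n$; set $\mathbf{z}_0=\mathbf{x}_0$, $\mathbf{y}_1=\mathbf{x}_0-\frac1\alpha G_{1/L}(\mathbf{x}_0)$, and $\tilde\xi_1^2=\left(\frac1{\alpha^2}-\frac1{L\alpha}\right)\|G_{1/L}(\mathbf{x}_0)\|^2$. For $k=1,2,\ldots$: (a) let $\mathbf{z}_k\in\mathrm{aff}\{\bar{\mathbf{z}}_{k-1},\mathbf{y}_k\}$ be any point with $F(\bar{\mathbf{z}}_k)\le F(\bar{\mathbf{z}}_{k-1})-\frac1{2L}\|G_{1/L}(\mathbf{z}_k)\|^2$ and $G_{1/L}(\mathbf{z}_k)^T(\mathbf{y}_k-\mathbf{z}_k)\ge0$; (b) set $\tilde\rho_k^2=\left(1-\frac{\alpha}{L}\right)\frac{\|G_{1/L}(\mathbf{z}_k)\|^2}{\alpha^2}$, $\tilde\sigma_k^2=\tilde\xi_k^2-\frac{\alpha}{L}\frac{\|G_{1/L}(\mathbf{z}_k)\|^2}{\alpha^2}$, $\delta_k^2=\frac{\|G_{1/L}(\mathbf{z}_k)\|^2}{\alpha^2}$; (c) if $\tilde\sigma_k^2\le\tilde\rho_k^2+\delta_k^2$, set $\lambda_{k+1}=\frac{\delta_k^2+\tilde\rho_k^2-\tilde\sigma_k^2}{2\delta_k^2}$ and $\tilde\xi_{k+1}^2=\frac{\tilde\rho_k^2}{2}+\frac{\tilde\sigma_k^2}{2}-\frac{\delta_k^2}{4}-\frac{(\tilde\rho_k^2-\tilde\sigma_k^2)^2}{4\delta_k^2}$;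 otherwise set $\lambda_{k+1}=0$ and $\tilde\xi_{k+1}^2=\tilde\rho_k^2$; (d) set $\mathbf{y}_{k+1}=(1-\lambda_{k+1})\bar{\bar{\mathbf{z}}}_k+\lambda_{k+1}\mathbf{y}_k$. Here $\tilde\xi_k^2,\tilde\rho_k^2,\tilde\sigma_k^2,\delta_k^2$ are simply names of real numbers. The iteration is considered as long as the formulas are defined, i.e. $\delta_k\neq0$ whenever the first case of (c) is used. *)

theory Defs
  imports "HOL-Analysis.Analysis"
begin

definition gradient :: "('a::real_inner \<Rightarrow> real) \<Rightarrow> 'a \<Rightarrow> 'a" where
  "gradient f x = (THE D. GDERIV f x :> D)"

definition L_smooth :: "real \<Rightarrow> ('a::real_inner \<Rightarrow> real) \<Rightarrow> bool" where
  "L_smooth L f \<longleftrightarrow> (\<forall>x. f differentiable (at x)) \<and>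
     (\<forall>x y. \<bar>f x - f y - gradient f y \<bullet> (x - y)\<bar> \<le> L / 2 * (norm (x - y))\<^sup>2)"

text \<open>Meaningful for differentiable functions only; differentiability is part of \<open>L_smooth\<close>.\<close>

definition strongly_convex :: "real \<Rightarrow> ('a::real_inner \<Rightarrow> real) \<Rightarrow> bool" where
  "strongly_convex \<alpha> f \<longleftrightarrow>
     (\<forall>x y. f y \<ge> f x + gradient f x \<bullet> (y - x) + \<alpha> / 2 * (norm (x - y))\<^sup>2)"

text \<open>Closedness and convexity of extended-valued functions are those of the epigraph,
  a subset of \<open>'a \<times> real\<close> (the library's \<open>epigraph\<close> covers real-valued functions only).\<close>

definition ereal_epigraph :: "('a \<Rightarrow> ereal) \<Rightarrow> ('a \<times> real) set" where
  "ereal_epigraph \<Psi> = {(x, r). \<Psi> x \<le> ereal r}"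

definition closed_fun :: "('a::topological_space \<Rightarrow> ereal) \<Rightarrow> bool" where
  "closed_fun \<Psi> \<longleftrightarrow> closed (ereal_epigraph \<Psi>)"

definition convex_fun :: "('a::real_vector \<Rightarrow> ereal) \<Rightarrow> bool" where
  "convex_fun \<Psi> \<longleftrightarrow> convex (ereal_epigraph \<Psi>)"

definition proper_fun :: "('a \<Rightarrow> ereal) \<Rightarrow> bool" where
  "proper_fun \<Psi> \<longleftrightarrow> (\<forall>x. \<Psi> x \<noteq> -\<infinity>) \<and> (\<exists>x. \<Psi> x \<noteq> \<infinity>)"

text \<open>For closed, proper, convex \<open>\<Psi>\<close> on a Euclidean space and \<open>t > 0\<close> the minimiser exists and is
  unique, so the choice made by \<open>arg_min\<close> is immaterial.\<close>

definition prox :: "real \<Rightarrow> ('a::real_normed_vector \<Rightarrow> ereal) \<Rightarrow> 'a \<Rightarrow> 'a" where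
  "prox t \<Psi> x = (ARG_MIN (\<lambda>z. \<Psi> z + ereal ((norm (x - z))\<^sup>2 / (2 * t))) z. True)"

definition grad_map :: "('a::real_inner \<Rightarrow> real) \<Rightarrow> ('a \<Rightarrow> ereal) \<Rightarrow> real \<Rightarrow> 'a \<Rightarrow> 'a" where
  "grad_map f \<Psi> t x = (1 / t) *\<^sub>R (x - prox t \<Psi> (x - t *\<^sub>R gradient f x))"

text \<open>The next two functions are the case distinction of a step. Their arguments \<open>d\<close>, \<open>r\<close>, \<open>s\<close> stand
  for the numbers \<open>\<delta>\<^sub>k\<^sup>2\<close>, \<open>\<rho>\<^sub>k\<^sup>2\<close>, \<open>\<sigma>\<^sub>k\<^sup>2\<close>; \<open>r\<close> and \<open>s\<close> need not be squares of reals.\<close>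

definition next_lambda :: "real \<Rightarrow> real \<Rightarrow> real \<Rightarrow> real" where
  "next_lambda d r s = (if s \<le> r + d then (d + r - s) / (2 * d) else 0)"

definition next_xi_sq :: "real \<Rightarrow> real \<Rightarrow> real \<Rightarrow> real" where
  "next_xi_sq d r s =
     (if s \<le> r + d then r / 2 + s / 2 - d / 4 - (r - s)\<^sup>2 / (4 * d) else r)"

text \<open>One step, from \<open>z\<^sub>k\<^sub>-\<^sub>1\<close>, \<open>y\<^sub>k\<close>, \<open>\<xi>\<^sub>k\<^sup>2\<close> to \<open>z\<^sub>k\<close>, \<open>y\<^sub>k\<^sub>+\<^sub>1\<close>, \<open>\<xi>\<^sub>k\<^sub>+\<^sub>1\<^sup>2\<close>. It is a relation since \<open>z\<^sub>k\<close> may be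
  any admissible point. The conjunct \<open>s \<le> r + d \<longrightarrow> d \<noteq> 0\<close> says that the formulas are defined
  (HOL division is total).\<close>

definition geometric_descent_step ::
  "('a::euclidean_space \<Rightarrow> real) \<Rightarrow> ('a \<Rightarrow> ereal) \<Rightarrow> real \<Rightarrow> real \<Rightarrow>
   'a \<Rightarrow> 'a \<Rightarrow> real \<Rightarrow> 'a \<Rightarrow> 'a \<Rightarrow> real \<Rightarrow> bool" where
  "geometric_descent_step f \<Psi> L \<alpha> z_prev y xi_sq z y_next xi_sq_next \<longleftrightarrow>
    (let F = (\<lambda>x. ereal (f x) + \<Psi> x);
         G = grad_map f \<Psi> (1 / L);
         bar = (\<lambda>x. x - (1 / L) *\<^sub>R G x);
         barbar = (\<lambda>x. x - (1 / \<alpha>) *\<^sub>R G x);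
         r = (1 - \<alpha> / L) * ((norm (G z))\<^sup>2 / \<alpha>\<^sup>2);
         s = xi_sq - \<alpha> / L * ((norm (G z))\<^sup>2 / \<alpha>\<^sup>2);
         d = (norm (G z))\<^sup>2 / \<alpha>\<^sup>2;
         lam = next_lambda d r s
     in z \<in> affine hull {bar z_prev, y}
        \<and> F (bar z) \<le> F (bar z_prev) - ereal (1 / (2 * L) * (norm (G z))\<^sup>2)
        \<and> G z \<bullet> (y - z) \<ge> 0
        \<and> (s \<le> r + d \<longrightarrow> d \<noteq> 0)
        \<and> xi_sq_next = next_xi_sq d r s
        \<and> y_next = (1 - lam) *\<^sub>R barbar z + lam *\<^sub>R y)"

text \<open>A run performing the steps \<open>k = 1, 2, \<dots>\<close> with \<open>k \<le> N\<close>, where \<open>N = \<infinity>\<close> for a run that never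
  becomes undefined. The values \<open>y 0\<close> and \<open>xi_sq 0\<close> are not used.\<close>

definition geometric_descent ::
  "('a::euclidean_space \<Rightarrow> real) \<Rightarrow> ('a \<Rightarrow> ereal) \<Rightarrow> real \<Rightarrow> real \<Rightarrow> 'a \<Rightarrow> enat \<Rightarrow>
   (nat \<Rightarrow> 'a) \<Rightarrow> (nat \<Rightarrow> 'a) \<Rightarrow> (nat \<Rightarrow> real) \<Rightarrow> bool" where
  "geometric_descent f \<Psi> L \<alpha> x0 N z y xi_sq \<longleftrightarrow>
     z 0 = x0
     \<and> y 1 = x0 - (1 / \<alpha>) *\<^sub>R grad_map f \<Psi> (1 / L) x0
     \<and> xi_sq 1 = (1 / \<alpha>\<^sup>2 - 1 / (L * \<alpha>)) * (norm (grad_map f \<Psi> (1 / L) x0))\<^sup>2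
     \<and> (\<forall>k\<ge>1. enat k \<le> N \<longrightarrow>
          geometric_descent_step f \<Psi> L \<alpha> (z (k - 1)) (y k) (xi_sq k)
            (z k) (y (k + 1)) (xi_sq (k + 1)))"

end

theory Submission
  imports Defs
begin

text \<open>Put \<open>c\<^sup>2 = \<alpha> / L\<close>, \<open>d = \<delta>\<^sub>k\<^sup>2\<close> and \<open>X = \<xi>\<^sub>k\<^sup>2\<close>, so that \<open>\<rho>\<^sub>k\<^sup>2 = (1 - c\<^sup>2) d\<close> and \<open>\<sigma>\<^sub>k\<^sup>2 = X - c\<^sup>2 d\<close>.
  The case condition reads \<open>X \<le> 2 d\<close>. In the first case the new value is \<open>X - (c\<^sup>2 d + X\<^sup>2 / (4 d))\<close>,
  which AM-GM bounds by \<open>(1 - c) X\<close>. In the second it is \<open>(1 - c) (1 + c) d \<le> (1 - c) 2 d \<le> (1 - c) X\<close>,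
  because \<open>c \<le> 1\<close>: strong convexity and smoothness together force \<open>\<alpha> \<le> L\<close>.\<close>

text \<open>Along a unit vector \<open>h\<close> from the origin the linear terms of both bounds
  agree, which leaves \<open>\<alpha> / 2 \<le> L / 2\<close>. A nonzero vector is essential: in
  dimension zero the claim would fail.\<close>

lemma strong_convexity_le_smoothness:
  fixes f :: "'a::euclidean_space \<Rightarrow> real"
  assumes "L_smooth L f" and "strongly_convex \<alpha> f"
  shows "\<alpha> \<le> L"
proof -
  obtain h :: 'a where "h \<in> Basis"
    using nonempty_Basis by blast
  then have "norm h = 1"
    by (rule norm_Basis)
  moreover have "\<bar>f h - f 0 - gradient f 0 \<bullet> (h - 0)\<bar> \<le> L / 2 * (norm (h - 0))\<^sup>2"
    using assms(1) unfolding L_smooth_def by blast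
  moreover have "f h \<ge> f 0 + gradient f 0 \<bullet> (h - 0) + \<alpha> / 2 * (norm (0 - h))\<^sup>2"
    using assms(2) unfolding strongly_convex_def by blast
  ultimately show ?thesis
    by (simp add: abs_if split: if_splits)
qed

lemma next_xi_sq_le:
  fixes c d X :: real
  assumes "0 \<le> c" and "c \<le> 1" and "0 \<le> d" and nz: "X \<le> 2 * d \<longrightarrow> d \<noteq> 0"
  shows "next_xi_sq d ((1 - c\<^sup>2) * d) (X - c\<^sup>2 * d) \<le> (1 - c) * X"
proof (cases "X \<le> 2 * d")
  case True
  with nz \<open>0 \<le> d\<close> have "d > 0"
    by simp
  from True have "X - c\<^sup>2 * d \<le> (1 - c\<^sup>2) * d + d"
    by (simp add: algebra_simps)
  \<comment> \<open>The subtracted square is the AM-GM gap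
    \<open>c\<^sup>2 * d + X\<^sup>2 / (4 * d) - c * X\<close>.\<close>
  then have "next_xi_sq d ((1 - c\<^sup>2) * d) (X - c\<^sup>2 * d) = (1 - c) * X - (2 * c * d - X)\<^sup>2 / (4 * d)"
    using \<open>d > 0\<close> unfolding next_xi_sq_def
    by (simp add: field_simps power2_eq_square)
  also have "\<dots> \<le> (1 - c) * X"
    using \<open>d > 0\<close> by simp
  finally show ?thesis .
next
  case False
  then have "\<not> X - c\<^sup>2 * d \<le> (1 - c\<^sup>2) * d + d"
    by (simp add: algebra_simps)
  then have "next_xi_sq d ((1 - c\<^sup>2) * d) (X - c\<^sup>2 * d) = (1 - c) * ((1 + c) * d)"
    unfolding next_xi_sq_def by (simp add: algebra_simps power2_eq_square)
  also have "(1 + c) * d \<le> 2 * d"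
    using assms by (intro mult_right_mono) auto
  then have "(1 - c) * ((1 + c) * d) \<le> (1 - c) * X"
    using False \<open>c \<le> 1\<close> by (intro mult_left_mono) auto
  finally show ?thesis .
qed

theorem theorem5p2:
  fixes f :: "real ^ 'n \<Rightarrow> real" and \<Psi> :: "real ^ 'n \<Rightarrow> ereal"
    and L \<alpha> :: real and x0 :: "real ^ 'n" and N :: enat
    and z y :: "nat \<Rightarrow> real ^ 'n" and xi_sq :: "nat \<Rightarrow> real" and k :: nat
  assumes "L > 0" and "\<alpha> > 0"
    and "L_smooth L f" and "strongly_convex \<alpha> f"
    and "closed_fun \<Psi>" and "proper_fun \<Psi>" and "convex_fun \<Psi>"
    and "geometric_descent f \<Psi> L \<alpha> x0 N z y xi_sq"
    and "k \<ge> 1" and "enat k \<le> N"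
  shows "xi_sq (k + 1) \<le> (1 - sqrt (\<alpha> / L)) * xi_sq k"
proof -
  define d where "d = (norm (grad_map f \<Psi> (1 / L) (z k)))\<^sup>2 / \<alpha>\<^sup>2"
  define c where "c = sqrt (\<alpha> / L)"
  have "geometric_descent_step f \<Psi> L \<alpha> (z (k - 1)) (y k) (xi_sq k) (z k) (y (k + 1)) (xi_sq (k + 1))"
    using assms unfolding geometric_descent_def by blast
  \<comment> \<open>Writing the ratio as a square brings the step's formulas into the form of
    \<open>next_xi_sq_le\<close>.\<close>
  moreover have c2: "\<alpha> / L = c\<^sup>2"
    using assms(1,2) by (simp add: c_def)
  ultimately have xi: "xi_sq (k + 1) = next_xi_sq d ((1 - c\<^sup>2) * d) (xi_sq k - c\<^sup>2 * d)"
    and "xi_sq k - c\<^sup>2 * d \<le> (1 - c\<^sup>2) * d + d \<longrightarrow> d \<noteq> 0"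
    unfolding geometric_descent_step_def Let_def d_def by auto
  then have "xi_sq k \<le> 2 * d \<longrightarrow> d \<noteq> 0"
    by (simp add: algebra_simps)
  moreover have "0 \<le> c" "c \<le> 1"
    using strong_convexity_le_smoothness[OF assms(3,4)] assms(1,2) by (simp_all add: c_def)
  moreover have "0 \<le> d"
    by (simp add: d_def)
  ultimately show ?thesis
    unfolding xi c_def[symmetric] by (intro next_xi_sq_le)
qed

end
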